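(* There is a basis $\{\mathbf{x}_A : A\in\Pi_n,\ n\ge 0\}$ of $\mathsf{NCSym}$ (indexed by all set partitions) such that (i) $\mathbf{x}_A\,\mathbf{x}_B=\mathbf{x}_{A|B}$ for all set partitions $A\in\Pi_n$, $B\in\Pi_m$, $n,m\ge 0$; (ii) $\Delta^{\odot}(\mathbf{x}_C)=\sum_{A\vee B=C}\mathbf{x}_A\otimes\mathbf{x}_B$ for all $C\in\Pi_n$, $n\ge 0$, where the sum is over all pairs $(A,B)\in\Pi_n\times\Pi_n$ with $A\vee B=C$.
   Context: $\Bbbk$ is a field of characteristic zero. $\Pi_n$ is the set of set partitions of $[n]=\{1,\dots,n\}$ ($\Pi_0$ consists only of the empty set partition), ordered by $A\le B$ iff every part of $A$ is contained in a part of $B$ (i.e. $A$ is finer than $B$). It is a lattice with meet $\wedge$ and join $\vee$, minimal element $\mathbf{0}_n=\{\{1\},\dots,\{n\}\}$ and maximal element $\mathbf{1}_n=\{[n]\}$. For $A\in\Pi_n$, $B\in\Pi_m$, the set partition $A|B\in\Pi_{n+m}$ consists of the parts of $A$ together with the parts of $B$ with every element shifted by $n$. $\mathsf{NCSym}=\bigoplus_{d\ge0}\mathsf{NCSym}_d$ is the $\Bbbk$-algebra of symmetric functions in noncommutative variables $x_1,x_2,\dots$. The space $\mathsf{NCSym}_d$ has basis $\{\mathbf{m}_A\}_{A\in\Pi_d}$, where $\mathbf{m}_A=\sum x_{i_1}x_{i_2}\cdots x_{i_d}$ is the formal sum over all sequences $(i_1,\dots,i_d)$ of positive integers such that $i_a=i_b$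 if and only if $a$ and $b$ are in the same part of $A$ (and $\mathbf{m}_\emptyset=1$). The product (induced by concatenation of words) is, for $A\in\Pi_d$, $B\in\Pi_m$, $$\mathbf{m}_A\mathbf{m}_B=\sum_{C\in\Pi_{d+m},\ C\wedge(\mathbf{1}_d|\mathbf{1}_m)=A|B}\mathbf{m}_C .$$ The internal comultiplication $\Delta^{\odot}:\mathsf{NCSym}_d\to\mathsf{NCSym}_d\otimes\mathsf{NCSym}_d$ is the linear map with $\Delta^{\odot}(\mathbf{m}_A)=\sum_{B\wedge C=A}\mathbf{m}_B\otimes\mathbf{m}_C$ (sum over pairs $(B,C)\in\Pi_d\times\Pi_d$). *)

theory Defs
  imports
    Complex_Main
    "HOL-Library.Disjoint_Sets"
    "HOL-Library.Function_Algebras"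
    "HOL-Algebra.Lattice"
begin

section \<open>Set partitions\<close>

definition set_partitions :: "nat \<Rightarrow> nat set set set" where
  "set_partitions n = {A. partition_on {1..n} A}"

definition partition_lattice :: "nat \<Rightarrow> nat set set gorder" where
  "partition_lattice n = \<lparr>carrier = set_partitions n, eq = (=), le = refines {1..n}\<rparr>"

definition max_partition :: "nat \<Rightarrow> nat set set" where
  "max_partition n = {{1..n}} - {{}}"

text \<open>The only member of \<open>set_partitions 0\<close> is \<open>{}\<close>, hence the removal of the empty part above.
  \<open>slash n A B\<close> is \<open>A|B\<close> for \<open>A\<close> a set partition of \<open>{1..n}\<close>; the shift \<open>n\<close> is explicit.\<close>

definition slash :: "nat \<Rightarrow> nat set set \<Rightarrow> nat set set \<Rightarrow> nat set set" where
  "slash n A B = A \<union> (\<lambda>P. (\<lambda>i. i + n) ` P) ` B"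


section \<open>Formal series in noncommutative variables\<close>

text \<open>
  A word \<open>x\<^sub>i\<^sub>1 \<dots> x\<^sub>i\<^sub>d\<close> is the list \<open>[i\<^sub>1, \<dots>, i\<^sub>d]\<close>, and a formal (possibly infinite) linear combination
  of words is its coefficient function \<open>nat list \<Rightarrow> 'k\<close>.  The vector space structure is pointwise;
  the product is concatenation of words, \<^emph>\<open>not\<close> the pointwise product of functions.
\<close>

definition fscale :: "'k::field \<Rightarrow> ('a \<Rightarrow> 'k) \<Rightarrow> 'a \<Rightarrow> 'k" where
  "fscale c f = (\<lambda>w. c * f w)"

global_interpretation fvs: vector_space fscale
  by unfold_locales (auto simp: fscale_def algebra_simps)

definition concat_mult :: "(nat list \<Rightarrow> 'k::field) \<Rightarrow> (nat list \<Rightarrow> 'k) \<Rightarrow> nat list \<Rightarrow> 'k" where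
  "concat_mult f g = (\<lambda>w. \<Sum>k\<le>length w. f (take k w) * g (drop k w))"

text \<open>Letters are positive integers, so words containing \<open>0\<close> get coefficient \<open>0\<close>.  Positions are
  counted from \<open>1\<close>, whence \<open>w ! (a - 1)\<close>.\<close>

definition monomial_sym :: "nat set set \<Rightarrow> nat list \<Rightarrow> 'k::field" where
  "monomial_sym A = (\<lambda>w. if length w = card (\<Union>A) \<and> 0 \<notin> set w \<and>
      (\<forall>a\<in>{1..length w}. \<forall>b\<in>{1..length w}.
         w ! (a - 1) = w ! (b - 1) \<longleftrightarrow> (\<exists>P\<in>A. a \<in> P \<and> b \<in> P))
    then 1 else 0)"

definition NCSym_deg :: "nat \<Rightarrow> (nat list \<Rightarrow> 'k::field) set" where
  "NCSym_deg d = fvs.span (monomial_sym ` set_partitions d)"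

definition NCSym :: "(nat list \<Rightarrow> 'k::field) set" where
  "NCSym = fvs.span (monomial_sym ` (\<Union>d. set_partitions d))"


section \<open>The internal comultiplication\<close>

text \<open>The tensor product of two spaces of functions is identified with its image under the canonical
  injection \<open>f \<otimes> g \<mapsto> (\<lambda>(u, v). f u * g v)\<close> into the functions of two words.\<close>

definition tensor :: "('a \<Rightarrow> 'k::field) \<Rightarrow> ('b \<Rightarrow> 'k) \<Rightarrow> 'a \<times> 'b \<Rightarrow> 'k" where
  "tensor f g = (\<lambda>(u, v). f u * g v)"

text \<open>The linear extension from the basis \<open>monomial_sym ` set_partitions d\<close> of \<open>NCSym_deg d\<close>;
  only its values on \<open>NCSym_deg d\<close> are meaningful.\<close>

definition internal_comult ::
  "nat \<Rightarrow> (nat list \<Rightarrow> 'k::field) \<Rightarrow> nat list \<times> nat list \<Rightarrow> 'k" where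
  "internal_comult d f =
    (\<Sum>A\<in>set_partitions d.
       fscale (fvs.representation (monomial_sym ` set_partitions d) f (monomial_sym A))
         (\<Sum>(B, C) \<in> {(B, C) \<in> set_partitions d \<times> set_partitions d.
                        B \<sqinter>\<^bsub>partition_lattice d\<^esub> C = A}.
            tensor (monomial_sym B) (monomial_sym C)))"


section \<open>Consistency of the definitions\<close>

text \<open>
  The meets and joins above exist (\<open>lattice_partition_lattice\<close>); the \<open>monomial_sym A\<close>, and their
  pairwise tensors, are linearly independent; \<open>concat_mult\<close> and \<open>internal_comult\<close> satisfy the defining
  formulas of the product and of the internal comultiplication on the basis
  (\<open>concat_mult_monomial_sym\<close>, \<open>internal_comult_monomial_sym\<close>), and \<open>internal_comult\<close> is linear.
\<close>

lemma partition_on_unique: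
  assumes "partition_on S A" "P \<in> A" "Q \<in> A" "a \<in> P" "a \<in> Q"
  shows "P = Q"
  using assms unfolding partition_on_def by (meson disjointD disjoint_iff)

lemma finite_set_partitions: "finite (set_partitions n)"
  unfolding set_partitions_def by (simp add: finitely_many_partition_on)

lemma max_partition_same_part:
  "max_partition n \<in> set_partitions n"
  "(\<exists>P\<in>max_partition n. a \<in> P \<and> b \<in> P) \<longleftrightarrow> a \<in> {1..n} \<and> b \<in> {1..n}"
  by (auto simp: max_partition_def set_partitions_def partition_on_def disjoint_def)

lemma lattice_partition_lattice: "lattice (partition_lattice n)"
proof -
  interpret partial_order "partition_lattice n"
    by unfold_locales
      (auto simp: partition_lattice_def set_partitions_def refines_refl
            simp del: One_nat_def intro: refines_trans dest: refines_asym)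
  show ?thesis
  proof
    fix A B assume AB: "A \<in> carrier (partition_lattice n)" "B \<in> carrier (partition_lattice n)"
    show "\<exists>s. is_glb (partition_lattice n) s {A, B}"
      using AB common_refinement_coarsest[of "{A, B}" "{1..n}"]
        partition_on_common_refinement[of "{A, B}" "{1..n}"]
        refines_common_refinement[of "{A, B}" "{1..n}"]
      by (intro exI[of _ "common_refinement {A, B}"])
        (auto simp: greatest_def Lower_def partition_lattice_def set_partitions_def)
    define U where "U = {C \<in> set_partitions n. refines {1..n} A C \<and> refines {1..n} B C}"
    have "refines {1..n} C (max_partition n)" if "partition_on {1..n} C" for C
      unfolding refines_def
    proof (intro conjI ballI that)
      show "partition_on {1..n} (max_partition n)"
        using max_partition_same_part(1) by (simp add: set_partitions_def)
      fix X assume "X \<in> C"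
      then have "X \<subseteq> {1..n}" "X \<noteq> {}" using that by (auto simp: partition_on_def)
      then show "\<exists>Y\<in>max_partition n. X \<subseteq> Y"
        unfolding max_partition_def by (intro bexI[of _ "{1..n}"]) auto
    qed
    then have "max_partition n \<in> U"
      using AB max_partition_same_part(1)[of n]
      by (simp add: U_def partition_lattice_def set_partitions_def)
    then have U: "U \<noteq> {}" by auto
    have P: "\<And>C. C \<in> U \<Longrightarrow> partition_on {1..n} C" by (auto simp: U_def set_partitions_def)
    show "\<exists>s. is_lub (partition_lattice n) s {A, B}"
      using AB common_refinement_coarsest[of U "{1..n}", OF P _ _ U]
        partition_on_common_refinement[of U "{1..n}", OF P U]
        refines_common_refinement[of U "{1..n}", OF P]
      by (intro exI[of _ "common_refinement U"])
        (auto simp: least_def Upper_def partition_lattice_def set_partitions_def U_def)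
  qed
qed

lemma meet_iff_same_part:
  assumes "A \<in> set_partitions n" "B \<in> set_partitions n"
  shows "A \<sqinter>\<^bsub>partition_lattice n\<^esub> B \<in> set_partitions n"
    and "(\<exists>P\<in>A \<sqinter>\<^bsub>partition_lattice n\<^esub> B. a \<in> P \<and> b \<in> P) \<longleftrightarrow>
         (\<exists>P\<in>A. a \<in> P \<and> b \<in> P) \<and> (\<exists>P\<in>B. a \<in> P \<and> b \<in> P)"
proof -
  interpret lattice "partition_lattice n" by (rule lattice_partition_lattice)
  let ?M = "A \<sqinter>\<^bsub>partition_lattice n\<^esub> B" and ?C = "common_refinement {A, B}"
  have AB: "partition_on {1..n} A" "partition_on {1..n} B"
    using assms by (auto simp: set_partitions_def)
  have M: "partition_on {1..n} ?M" "refines {1..n} ?M A" "refines {1..n} ?M B"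
    using meet_closed[of A B] meet_left[of A B] meet_right[of A B] assms
    by (auto simp: partition_lattice_def set_partitions_def)
  then show "?M \<in> set_partitions n" by (simp add: set_partitions_def)
  have C: "partition_on {1..n} ?C" "refines {1..n} ?C A" "refines {1..n} ?C B"
    using AB partition_on_common_refinement[of "{A, B}" "{1..n}"]
      refines_common_refinement[of "{A, B}" "{1..n}"] by auto
  have "refines {1..n} ?C ?M"
    using meet_le[of ?C A B] assms C by (auto simp: partition_lattice_def set_partitions_def)
  moreover have "refines {1..n} ?M ?C"
    using common_refinement_coarsest[of "{A, B}" "{1..n}" ?M] AB M by auto
  ultimately have eq: "?M = ?C" by (rule refines_asym[rotated])
  show "(\<exists>P\<in>?M. a \<in> P \<and> b \<in> P) \<longleftrightarrow>
        (\<exists>P\<in>A. a \<in> P \<and> b \<in> P) \<and> (\<exists>P\<in>B. a \<in> P \<and> b \<in> P)" (is "?L \<longleftrightarrow> ?R")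
  proof
    assume ?L
    then obtain X where X: "X \<in> ?M" "a \<in> X" "b \<in> X" by blast
    obtain P Q where "P \<in> A" "X \<subseteq> P" "Q \<in> B" "X \<subseteq> Q"
      using M(2,3) X(1) unfolding refines_def by meson
    then show ?R using X by blast
  next
    assume ?R
    then obtain P Q where PQ: "P \<in> A" "a \<in> P" "b \<in> P" "Q \<in> B" "a \<in> Q" "b \<in> Q" by blast
    define f where "f = (\<lambda>X. if X = A then P else Q)"
    have "P = Q" if "A = B"
      using PQ AB that partition_on_unique by metis
    then have "P \<inter> Q \<in> {\<Inter> (f ` {A, B})}" by (auto simp: f_def)
    moreover have "f \<in> (\<Pi> X\<in>{A, B}. X)" using PQ by (auto simp: f_def)
    ultimately have "P \<inter> Q \<in> (\<Union>f \<in> (\<Pi> X\<in>{A, B}. X). {\<Inter> (f ` {A, B})})" by (rule UN_I[rotated])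
    moreover have "P \<inter> Q \<notin> {{}}" using PQ by blast
    ultimately have "P \<inter> Q \<in> ?C" unfolding common_refinement by (rule DiffI)
    then show ?L unfolding eq using PQ by (intro bexI[of _ "P \<inter> Q"] conjI IntI)
  qed
qed

lemma set_partitions_eqI:
  assumes "A \<in> set_partitions n" "B \<in> set_partitions n"
    and "\<And>a b. a \<in> {1..n} \<Longrightarrow> b \<in> {1..n} \<Longrightarrow>
           (\<exists>P\<in>A. a \<in> P \<and> b \<in> P) \<longleftrightarrow> (\<exists>P\<in>B. a \<in> P \<and> b \<in> P)"
  shows "A = B"
proof -
  have *: "refines {1..n} A B"
    if A: "partition_on {1..n} A" and B: "partition_on {1..n} B"
      and H: "\<And>a b. a \<in> {1..n} \<Longrightarrow> b \<in> {1..n} \<Longrightarrow>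
           (\<exists>P\<in>A. a \<in> P \<and> b \<in> P) \<longleftrightarrow> (\<exists>P\<in>B. a \<in> P \<and> b \<in> P)" for A B
    unfolding refines_def
  proof (intro conjI ballI A B)
    fix X assume X: "X \<in> A"
    have "X \<noteq> {}" using X A by (auto simp: partition_on_def)
    then obtain a where a: "a \<in> X" by blast
    have sub: "X \<subseteq> {1..n}" using X A by (auto simp: partition_on_def)
    obtain Y where Y: "Y \<in> B" "a \<in> Y" using a sub B by (auto simp: partition_on_def)
    have "b \<in> Y" if bX: "b \<in> X" for b
    proof -
      obtain Z where "Z \<in> B" "a \<in> Z" "b \<in> Z" using H[of a b] a bX X sub by blast
      then show ?thesis using Y B partition_on_unique by metis
    qed
    then show "\<exists>Y\<in>B. X \<subseteq> Y" using Y by blast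
  qed
  show ?thesis
    by (rule refines_asym; rule *) (use assms in \<open>auto simp: set_partitions_def\<close>)
qed

lemma monomial_sym_eq:
  assumes "A \<in> set_partitions n"
  shows "monomial_sym A w = (if length w = n \<and> 0 \<notin> set w \<and>
      (\<forall>a\<in>{1..n}. \<forall>b\<in>{1..n}. w ! (a - 1) = w ! (b - 1) \<longleftrightarrow> (\<exists>P\<in>A. a \<in> P \<and> b \<in> P))
    then 1 else 0)"
proof -
  have "card (\<Union>A) = n" using assms by (simp add: set_partitions_def partition_on_def)
  then show ?thesis by (auto simp: monomial_sym_def)
qed

lemma monomial_sym_word:
  assumes "A \<in> set_partitions n"
  obtains w where "monomial_sym A w = (1 :: 'k::field)"
proof -
  have A: "partition_on {1..n} A" using assms by (simp add: set_partitions_def)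
  define f where "f a = Min (THE P. P \<in> A \<and> a \<in> P)" for a
  have f: "f a = Min P" if "P \<in> A" "a \<in> P" for a P
  proof -
    have "(THE P. P \<in> A \<and> a \<in> P) = P"
      using that partition_on_unique[OF A] by (intro the_equality) auto
    then show ?thesis by (simp add: f_def)
  qed
  have P: "Min P \<in> P \<and> P \<subseteq> {1..n}" if "P \<in> A" for P
  proof -
    have "P \<subseteq> {1..n}" "P \<noteq> {}" using that A by (auto simp: partition_on_def)
    then show ?thesis by (metis Min_in finite_atLeastAtMost finite_subset)
  qed
  have ex: "\<exists>P\<in>A. a \<in> P" if "a \<in> {1..n}" for a using that A by (auto simp: partition_on_def)
  have "f a = f b \<longleftrightarrow> (\<exists>P\<in>A. a \<in> P \<and> b \<in> P)" if ab: "a \<in> {1..n}" "b \<in> {1..n}" for a b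
  proof -
    obtain P Q where PQ: "P \<in> A" "a \<in> P" "Q \<in> A" "b \<in> Q" using ex ab by metis
    then have fab: "f a = Min P" "f b = Min Q" using f by auto
    show ?thesis
    proof
      assume "f a = f b"
      then have "P = Q"
        using fab P[of P] P[of Q] PQ partition_on_unique[OF A, of P Q "Min P"] by simp
      then show "\<exists>P\<in>A. a \<in> P \<and> b \<in> P" using PQ by blast
    next
      assume "\<exists>P\<in>A. a \<in> P \<and> b \<in> P"
      then show "f a = f b" using f by metis
    qed
  qed
  moreover have "f a \<noteq> 0" if "a \<in> {1..n}" for a
    using ex[OF that] f P by fastforce
  ultimately have "monomial_sym A (map f [1..<Suc n]) = (1 :: 'k)"
  proof -
    assume f_same: "\<And>a b. a \<in> {1..n} \<Longrightarrow> b \<in> {1..n} \<Longrightarrow> f a = f b \<longleftrightarrow> (\<exists>P\<in>A. a \<in> P \<and> b \<in> P)"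
      and f_pos: "\<And>a. a \<in> {1..n} \<Longrightarrow> f a \<noteq> 0"
    have "map f [1..<Suc n] ! (a - 1) = f a" if "a \<in> {1..n}" for a
      using that by (subst nth_map) (auto simp del: upt_Suc)
    moreover have "0 \<notin> set (map f [1..<Suc n])" using f_pos by force
    moreover have "length (map f [1..<Suc n]) = n" by simp
    ultimately show ?thesis
      unfolding monomial_sym_eq[OF assms] using f_same by (simp only: simp_thms ball_triv if_True cong: ball_cong)
  qed
  then show ?thesis using that by blast
qed

lemma monomial_sym_disjoint:
  assumes A: "A \<in> set_partitions n" and B: "B \<in> set_partitions m"
    and w: "monomial_sym A w \<noteq> (0 :: 'k::field)" "monomial_sym B w \<noteq> (0 :: 'k)"
  shows "A = B"
proof -
  have "n = m" using w unfolding monomial_sym_eq[OF A] monomial_sym_eq[OF B] by (auto split: if_splits)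
  with B have B': "B \<in> set_partitions n" by simp
  show ?thesis
    by (rule set_partitions_eqI[OF A B'])
      (use w in \<open>auto simp: monomial_sym_eq[OF A] monomial_sym_eq[OF B'] split: if_splits\<close>)
qed

lemma independent_if_separated:
  assumes "\<And>b. b \<in> S \<Longrightarrow> \<exists>p. b p \<noteq> 0 \<and> (\<forall>c\<in>S - {b}. c p = 0)"
  shows "fvs.independent S"
proof
  assume "fvs.dependent S"
  then obtain b where b: "b \<in> S" "b \<in> fvs.span (S - {b})" unfolding fvs.dependent_def by blast
  obtain p where p: "b p \<noteq> 0" "\<forall>c\<in>S - {b}. c p = 0" using assms[OF b(1)] by blast
  have "fvs.span (S - {b}) \<subseteq> {f. f p = 0}"
    by (rule fvs.span_minimal) (use p in \<open>auto simp: fvs.subspace_def fscale_def zero_fun_def\<close>)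
  then show False using b p by blast
qed

lemma independent_monomial_sym:
  "fvs.independent (monomial_sym ` (\<Union>n. set_partitions n) :: (nat list \<Rightarrow> 'k::field) set)"
proof (rule independent_if_separated)
  fix b :: "nat list \<Rightarrow> 'k" assume "b \<in> monomial_sym ` (\<Union>n. set_partitions n)"
  then obtain A n where A: "A \<in> set_partitions n" "b = monomial_sym A" by blast
  obtain w where "b w = 1" using monomial_sym_word[OF A(1)] A(2) by metis
  moreover have "c w = 0" if c: "c \<in> monomial_sym ` (\<Union>n. set_partitions n) - {b}" for c
  proof -
    obtain C m where "C \<in> set_partitions m" "c = monomial_sym C" using c by blast
    then show ?thesis
      using c A monomial_sym_disjoint[OF A(1), of C m w] \<open>b w = 1\<close> by (metis DiffE insertI1 zero_neq_one)
  qed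
  ultimately show "\<exists>p. b p \<noteq> 0 \<and> (\<forall>c\<in>monomial_sym ` (\<Union>n. set_partitions n) - {b}. c p = 0)"
    by (intro exI[of _ w]) auto
qed

lemma inj_on_monomial_sym:
  "inj_on (monomial_sym :: _ \<Rightarrow> nat list \<Rightarrow> 'k::field) (\<Union>n. set_partitions n)"
proof (rule inj_onI)
  fix A B :: "nat set set"
  assume "A \<in> (\<Union>n. set_partitions n)" "B \<in> (\<Union>n. set_partitions n)"
    and eq: "(monomial_sym A :: nat list \<Rightarrow> 'k) = monomial_sym B"
  then obtain n m where A: "A \<in> set_partitions n" and B: "B \<in> set_partitions m" by blast
  obtain w where "monomial_sym A w = (1 :: 'k)" using monomial_sym_word[OF A] by metis
  then show "A = B" using monomial_sym_disjoint[OF A B, of w] eq by (metis zero_neq_one)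
qed

lemma independent_tensor_monomial_sym:
  "fvs.independent ((\<lambda>(A, B). tensor (monomial_sym A) (monomial_sym B)) `
     ((\<Union>n. set_partitions n) \<times> (\<Union>n. set_partitions n)) ::
     (nat list \<times> nat list \<Rightarrow> 'k::field) set)"
proof (rule independent_if_separated)
  let ?T = "\<lambda>(A, B). tensor (monomial_sym A) (monomial_sym B) :: nat list \<times> nat list \<Rightarrow> 'k"
  let ?P = "\<Union>n. set_partitions n"
  fix b assume "b \<in> ?T ` (?P \<times> ?P)"
  then obtain A B n m where AB: "A \<in> set_partitions n" "B \<in> set_partitions m" "b = ?T (A, B)" by blast
  obtain u where u: "monomial_sym A u = (1 :: 'k)" using monomial_sym_word[OF AB(1)] by metis
  obtain v where v: "monomial_sym B v = (1 :: 'k)" using monomial_sym_word[OF AB(2)] by metis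
  have "c (u, v) = 0" if "c \<in> ?T ` (?P \<times> ?P) - {b}" for c
  proof -
    obtain C D k l where CD: "C \<in> set_partitions k" "D \<in> set_partitions l" "c = ?T (C, D)"
      using \<open>c \<in> _\<close> by blast
    have "\<not> (A = C \<and> B = D)" using that CD AB by blast
    then have "monomial_sym C u = (0 :: 'k) \<or> monomial_sym D v = (0 :: 'k)"
      using monomial_sym_disjoint[OF AB(1) CD(1), of u] monomial_sym_disjoint[OF AB(2) CD(2), of v] u v
      by (metis zero_neq_one)
    then show ?thesis using CD by (auto simp: tensor_def)
  qed
  moreover have "b (u, v) \<noteq> 0" using AB u v by (simp add: tensor_def)
  ultimately show "\<exists>p. b p \<noteq> 0 \<and> (\<forall>c\<in>?T ` (?P \<times> ?P) - {b}. c p = 0)" by blast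
qed

lemma independent_monomial_sym_deg:
  "fvs.independent (monomial_sym ` set_partitions d :: (nat list \<Rightarrow> 'k::field) set)"
  by (rule fvs.independent_mono[OF independent_monomial_sym]) blast

lemma internal_comult_add:
  assumes "f \<in> NCSym_deg d" "g \<in> NCSym_deg d"
  shows "internal_comult d (f + g) = internal_comult d f + internal_comult d g"
  using assms unfolding internal_comult_def NCSym_deg_def
  by (simp add: fvs.representation_add[OF independent_monomial_sym_deg] fvs.scale_left_distrib sum.distrib)

lemma internal_comult_fscale:
  assumes "f \<in> NCSym_deg d"
  shows "internal_comult d (fscale c f) = fscale c (internal_comult d f)"
  using assms unfolding internal_comult_def NCSym_deg_def
  by (simp add: fvs.representation_scale[OF independent_monomial_sym_deg] fvs.scale_sum_right)

lemma internal_comult_monomial_sym: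
  assumes "A \<in> set_partitions d"
  shows "internal_comult d (monomial_sym A :: nat list \<Rightarrow> 'k::field) =
    (\<Sum>(B, C) \<in> {(B, C) \<in> set_partitions d \<times> set_partitions d. B \<sqinter>\<^bsub>partition_lattice d\<^esub> C = A}.
       tensor (monomial_sym B) (monomial_sym C))"
proof -
  have *: "fvs.representation (monomial_sym ` set_partitions d) (monomial_sym A) (monomial_sym B) =
      (if B = A then 1 else (0 :: 'k))" if "B \<in> set_partitions d" for B
  proof -
    have "(monomial_sym B :: nat list \<Rightarrow> 'k) = monomial_sym A \<longleftrightarrow> B = A"
      using inj_on_monomial_sym[where 'k = 'k] that assms unfolding inj_on_def by blast
    moreover have "(monomial_sym A :: nat list \<Rightarrow> 'k) \<in> monomial_sym ` set_partitions d"
      using assms by blast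
    ultimately show ?thesis
      using fvs.representation_basis[OF independent_monomial_sym_deg, of "monomial_sym A :: _ \<Rightarrow> 'k" d]
      by simp
  qed
  have "internal_comult d (monomial_sym A :: nat list \<Rightarrow> 'k) =
    (\<Sum>B\<in>set_partitions d. if B = A then
      (\<Sum>(B, C) \<in> {(B, C) \<in> set_partitions d \<times> set_partitions d. B \<sqinter>\<^bsub>partition_lattice d\<^esub> C = A}.
       tensor (monomial_sym B) (monomial_sym C)) else 0)"
    unfolding internal_comult_def by (rule sum.cong) (auto simp: *)
  then show ?thesis using assms by (simp add: finite_set_partitions)
qed

lemma slash_in_set_partitions:
  assumes "A \<in> set_partitions n" "B \<in> set_partitions m"
  shows "slash n A B \<in> set_partitions (n + m)"
proof -
  have A: "partition_on {1..n} A" and B: "partition_on {1..m} B"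
    using assms by (auto simp: set_partitions_def)
  have img: "(\<lambda>i. i + n) ` {1..m} = {n+1..n+m}"
    by (simp add: image_add_atLeastAtMost' add.commute)
  have "partition_on ((\<lambda>i. i + n) ` {1..m}) ((\<lambda>P. (\<lambda>i. i + n) ` P) ` B - {{}})"
    by (rule partition_on_inj_image[OF B]) auto
  moreover have "(\<lambda>P. (\<lambda>i. i + n) ` P) ` B - {{}} = (\<lambda>P. (\<lambda>i. i + n) ` P) ` B"
    using B by (auto simp: partition_on_def)
  ultimately have "partition_on {n+1..n+m} ((\<lambda>P. (\<lambda>i. i + n) ` P) ` B)" using img by (simp add: add.commute)
  then have "partition_on ({1..n} \<union> {n+1..n+m}) (slash n A B)"
    using A disjoint_union[of A "(\<lambda>P. (\<lambda>i. i + n) ` P) ` B"]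
    unfolding slash_def partition_on_def by auto
  moreover have "{1..n} \<union> {n+1..n+m} = {1..n+m}" by auto
  ultimately show ?thesis by (simp add: set_partitions_def)
qed

lemma slash_same_part:
  assumes "A \<in> set_partitions n" "B \<in> set_partitions m" "a \<in> {1..n+m}" "b \<in> {1..n+m}"
  shows "(\<exists>P\<in>slash n A B. a \<in> P \<and> b \<in> P) \<longleftrightarrow>
    (if a \<le> n \<and> b \<le> n then \<exists>P\<in>A. a \<in> P \<and> b \<in> P
     else a > n \<and> b > n \<and> (\<exists>P\<in>B. a - n \<in> P \<and> b - n \<in> P))"
proof -
  have "\<Union>A = {1..n}" "\<Union>B = {1..m}"
    using assms(1,2) by (simp_all add: set_partitions_def partition_on_def)
  then have AB: "P \<in> A \<Longrightarrow> P \<subseteq> {1..n}" "P \<in> B \<Longrightarrow> P \<subseteq> {1..m}" for P by blast+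
  have A: "x \<le> n" if "P \<in> A" "x \<in> P" for P x using AB(1)[of P] that by auto
  have B: "x > 0" if "P \<in> B" "x \<in> P" for P x using AB(2)[of P] that by auto
  have s: "x \<in> (\<lambda>i. i + n) ` P \<longleftrightarrow> x > n \<and> x - n \<in> P" if "P \<in> B" for x P
  proof
    assume "x \<in> (\<lambda>i. i + n) ` P"
    then show "x > n \<and> x - n \<in> P" using B[OF that] by auto
  next
    assume "x > n \<and> x - n \<in> P"
    then show "x \<in> (\<lambda>i. i + n) ` P" by (intro image_eqI[of _ _ "x - n"]) auto
  qed
  have "(\<exists>P\<in>slash n A B. a \<in> P \<and> b \<in> P) \<longleftrightarrow>
      (\<exists>P\<in>A. a \<in> P \<and> b \<in> P) \<or> (\<exists>P\<in>B. a \<in> (\<lambda>i. i + n) ` P \<and> b \<in> (\<lambda>i. i + n) ` P)"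
    by (simp only: slash_def bex_Un bex_simps)
  also have "\<dots> \<longleftrightarrow>
      (\<exists>P\<in>A. a \<in> P \<and> b \<in> P) \<or> a > n \<and> b > n \<and> (\<exists>P\<in>B. a - n \<in> P \<and> b - n \<in> P)"
    using s by (simp cong: bex_cong) blast
  also have "\<dots> \<longleftrightarrow> (if a \<le> n \<and> b \<le> n then \<exists>P\<in>A. a \<in> P \<and> b \<in> P
      else a > n \<and> b > n \<and> (\<exists>P\<in>B. a - n \<in> P \<and> b - n \<in> P))"
    using A by (simp add: not_le) (meson leD)
  finally show ?thesis .
qed

lemma concat_mult_monomial_sym:
  assumes A: "A \<in> set_partitions n" and B: "B \<in> set_partitions m"
  shows "concat_mult (monomial_sym A) (monomial_sym B) =
    (\<Sum>C \<in> {C \<in> set_partitions (n + m).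
        C \<sqinter>\<^bsub>partition_lattice (n + m)\<^esub> slash n (max_partition n) (max_partition m) = slash n A B}.
       (monomial_sym C :: nat list \<Rightarrow> 'k::field))"
proof
  fix w :: "nat list"
  let ?N = "n + m"
  let ?S = "{C \<in> set_partitions ?N.
      C \<sqinter>\<^bsub>partition_lattice ?N\<^esub> slash n (max_partition n) (max_partition m) = slash n A B}"
  let ?J = "slash n (max_partition n) (max_partition m)"
  have sum_at: "(\<Sum>C\<in>S. f C) w = (\<Sum>C\<in>S. f C w)" for S and f :: "_ \<Rightarrow> nat list \<Rightarrow> 'k"
    by (induction S rule: infinite_finite_induct) auto
  have J: "?J \<in> set_partitions ?N" by (intro slash_in_set_partitions max_partition_same_part)
  have AB: "slash n A B \<in> set_partitions ?N" by (rule slash_in_set_partitions[OF A B])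
  show "concat_mult (monomial_sym A) (monomial_sym B) w = (\<Sum>C\<in>?S. (monomial_sym C :: _ \<Rightarrow> 'k)) w"
  proof (cases "length w = ?N \<and> 0 \<notin> set w")
    case False
    have "(\<Sum>C\<in>?S. (monomial_sym C :: _ \<Rightarrow> 'k)) w = 0"
      unfolding sum_at
      by (rule sum.neutral) (use False in \<open>auto simp: monomial_sym_eq[of _ ?N]\<close>)
    moreover
    have "(monomial_sym A (take k w) * monomial_sym B (drop k w) :: 'k) = 0"
      if "k \<le> length w" for k
      using that False in_set_takeD[of 0 k w] in_set_dropD[of 0 k w]
        set_append[of "take k w" "drop k w"]
      by (auto simp: monomial_sym_eq[OF A] monomial_sym_eq[OF B])
    then have "concat_mult (monomial_sym A) (monomial_sym B) w = (0 :: 'k)"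
      unfolding concat_mult_def by (intro sum.neutral) blast
    ultimately show ?thesis by simp
  next
    case True
    define K where "K = (\<lambda>a. {b \<in> {1..?N}. w ! (b - 1) = w ! (a - 1)}) ` {1..?N}"
    have K: "K \<in> set_partitions ?N"
      unfolding K_def set_partitions_def by (auto simp: partition_on_def disjoint_def)
    have K_same: "(\<exists>P\<in>K. a \<in> P \<and> b \<in> P) \<longleftrightarrow> w ! (a - 1) = w ! (b - 1)"
      if "a \<in> {1..?N}" "b \<in> {1..?N}" for a b
      using that unfolding K_def by auto
    have 1: "(monomial_sym K :: _ \<Rightarrow> 'k) w = 1"
      using True K_same by (auto simp: monomial_sym_eq[OF K])
    have 2: "(monomial_sym C :: _ \<Rightarrow> 'k) w = (if C = K then 1 else 0)" if "C \<in> ?S" for C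
      using monomial_sym_disjoint[OF _ K, of C ?N w] that 1 by (metis (mono_tags, lifting) mem_Collect_eq zero_neq_one)
    have "(\<Sum>C\<in>?S. (monomial_sym C :: _ \<Rightarrow> 'k)) w = (\<Sum>C\<in>?S. if C = K then 1 else 0)"
      unfolding sum_at by (rule sum.cong) (auto simp: 2)
    also have "\<dots> = (if K \<in> ?S then 1 else 0)"
      by (simp add: finite_set_partitions)
    finally have R: "(\<Sum>C\<in>?S. (monomial_sym C :: _ \<Rightarrow> 'k)) w = (if K \<in> ?S then 1 else 0)" .
    have "concat_mult (monomial_sym A) (monomial_sym B) w =
        (\<Sum>k\<le>length w. if k = n then monomial_sym A (take n w) * monomial_sym B (drop n w) else (0 :: 'k))"
      unfolding concat_mult_def using True
      by (intro sum.cong) (auto simp: monomial_sym_eq[OF A])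
    then have L: "concat_mult (monomial_sym A) (monomial_sym B) w =
        (monomial_sym A (take n w) * monomial_sym B (drop n w) :: 'k)"
      using True by simp
    let ?a = "\<forall>a\<in>{1..n}. \<forall>b\<in>{1..n}. w ! (a - 1) = w ! (b - 1) \<longleftrightarrow> (\<exists>P\<in>A. a \<in> P \<and> b \<in> P)"
    let ?b = "\<forall>a\<in>{1..m}. \<forall>b\<in>{1..m}.
      w ! (n + a - 1) = w ! (n + b - 1) \<longleftrightarrow> (\<exists>P\<in>B. a \<in> P \<and> b \<in> P)"
    have "monomial_sym A (take n w) = (if ?a then 1 else (0 :: 'k))"
    proof -
      have "take n w ! (a - 1) = w ! (a - 1)" if "a \<in> {1..n}" for a
        using that by (intro nth_take) auto
      moreover have "length (take n w) = n" "0 \<notin> set (take n w)"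
        using True in_set_takeD[of 0 n w] by auto
      ultimately show ?thesis
        unfolding monomial_sym_eq[OF A] by (simp only: simp_thms cong: ball_cong)
    qed
    moreover have "monomial_sym B (drop n w) = (if ?b then 1 else (0 :: 'k))"
    proof -
      have "drop n w ! (a - 1) = w ! (n + a - 1)" if "a \<in> {1..m}" for a
        using that True by (subst nth_drop) auto
      moreover have "length (drop n w) = m" "0 \<notin> set (drop n w)"
        using True in_set_dropD[of 0 n w] by auto
      ultimately show ?thesis
        unfolding monomial_sym_eq[OF B] by (simp only: simp_thms cong: ball_cong)
    qed
    moreover have "K \<in> ?S \<longleftrightarrow> ?a \<and> ?b"
    proof -
      note same = meet_iff_same_part(2)[OF K J]
      have J_same: "(\<exists>P\<in>?J. a \<in> P \<and> b \<in> P) \<longleftrightarrow> (a \<le> n \<longleftrightarrow> b \<le> n)"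
        if "a \<in> {1..?N}" "b \<in> {1..?N}" for a b
        using that slash_same_part[OF max_partition_same_part(1) max_partition_same_part(1), of a n m b]
          max_partition_same_part(2) by auto
      have M_same: "(\<exists>P\<in>K \<sqinter>\<^bsub>partition_lattice ?N\<^esub> ?J. a \<in> P \<and> b \<in> P) \<longleftrightarrow>
          w ! (a - 1) = w ! (b - 1) \<and> (a \<le> n \<longleftrightarrow> b \<le> n)"
        if "a \<in> {1..?N}" "b \<in> {1..?N}" for a b
        using that by (simp only: same K_same J_same)
      have "K \<in> ?S \<longleftrightarrow> (\<forall>a\<in>{1..?N}. \<forall>b\<in>{1..?N}.
          (w ! (a - 1) = w ! (b - 1) \<and> (a \<le> n \<longleftrightarrow> b \<le> n)) = (\<exists>P\<in>slash n A B. a \<in> P \<and> b \<in> P))"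
        (is "_ \<longleftrightarrow> ?Q")
      proof
        assume "K \<in> ?S"
        then have "K \<sqinter>\<^bsub>partition_lattice ?N\<^esub> ?J = slash n A B" by simp
        then show ?Q using M_same by (simp only: simp_thms ball_triv cong: ball_cong)
      next
        assume Q: ?Q
        have "K \<sqinter>\<^bsub>partition_lattice ?N\<^esub> ?J = slash n A B"
          by (rule set_partitions_eqI[OF meet_iff_same_part(1)[OF K J] AB])
            (simp only: M_same Q[rule_format])
        then show "K \<in> ?S" using K by simp
      qed
      also have "\<dots> \<longleftrightarrow> ?a \<and> ?b"
      proof
        assume Q: ?Q
        have ?a
        proof (intro ballI)
          fix a b assume "a \<in> {1..n}" "b \<in> {1..n}"
          then show "w ! (a - 1) = w ! (b - 1) \<longleftrightarrow> (\<exists>P\<in>A. a \<in> P \<and> b \<in> P)"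
            using Q[rule_format, of a b] slash_same_part[OF A B, of a b] by simp
        qed
        moreover have ?b
        proof (intro ballI)
          fix a b assume "a \<in> {1..m}" "b \<in> {1..m}"
          then show "w ! (n + a - 1) = w ! (n + b - 1) \<longleftrightarrow> (\<exists>P\<in>B. a \<in> P \<and> b \<in> P)"
            using Q[rule_format, of "n + a" "n + b"] slash_same_part[OF A B, of "n + a" "n + b"] by simp
        qed
        ultimately show "?a \<and> ?b" ..
      next
        assume ab: "?a \<and> ?b"
        show ?Q
        proof (intro ballI)
          fix a b assume r: "a \<in> {1..?N}" "b \<in> {1..?N}"
          consider "a \<le> n" "b \<le> n" | "a > n" "b > n" | "(a \<le> n) \<noteq> (b \<le> n)" by linarith
          then show "(w ! (a - 1) = w ! (b - 1) \<and> (a \<le> n \<longleftrightarrow> b \<le> n)) =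
              (\<exists>P\<in>slash n A B. a \<in> P \<and> b \<in> P)"
          proof cases
            case 1
            then show ?thesis
              using ab[THEN conjunct1, rule_format, of a b] r slash_same_part[OF A B r] by simp
          next
            case 2
            then have "a - n \<in> {1..m}" "b - n \<in> {1..m}" using r by auto
            with 2 show ?thesis
              using ab[THEN conjunct2, rule_format, of "a - n" "b - n"] r slash_same_part[OF A B r]
              by simp
          next
            case 3
            then show ?thesis
              unfolding slash_same_part[OF A B r] by (cases "a \<le> n"; cases "b \<le> n"; simp)
          qed
        qed
      qed
      finally show ?thesis .
    qed
    ultimately show ?thesis using L R by simp
  qed
qed

end

theory Submission
  imports Defs
begin

text \<open>
  The power sums \<open>p A = (\<Sum>B \<ge> A. m B)\<close> are multiplicative, \<open>p A * p B = p (A|B)\<close>, and group-like for the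
  internal comultiplication.  Define \<open>x\<close> by Moebius inversion from \<open>p A = (\<Sum>B \<le> A. x B)\<close>.  The
  partitions below \<open>A|B\<close> are exactly the \<open>C|D\<close> with \<open>C \<le> A\<close> and \<open>D \<le> B\<close>, so summing (i) over lower
  sets gives the multiplicativity of \<open>p\<close>; since \<open>A, B \<le> C\<close> iff \<open>A \<squnion> B \<le> C\<close>, summing (ii) over lower
  sets says that \<open>p C\<close> is group-like.  A function on partitions is determined by its sums over lower
  sets.
\<close>

declare One_nat_def [simp del]

section \<open>The refinement order\<close>

text \<open>Parts are nonempty and the parts of \<open>B\<close> are disjoint, so a part of
  \<open>A\<close> lies in a single part of \<open>B\<close> once its elements are pairwise together
  in \<open>B\<close>. The criterion on pairs makes \<open>slash_same_part\<close> applicable to the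
  order.\<close>

lemma refines_iff_same_part:
  assumes "A \<in> set_partitions n" "B \<in> set_partitions n"
  shows "refines {1..n} A B \<longleftrightarrow> (\<forall>a\<in>{1..n}. \<forall>b\<in>{1..n}.
    (\<exists>P\<in>A. a \<in> P \<and> b \<in> P) \<longrightarrow> (\<exists>P\<in>B. a \<in> P \<and> b \<in> P))" (is "?L \<longleftrightarrow> ?R")
proof
  assume ?L
  then show ?R unfolding refines_def by (meson subsetD)
next
  assume R: ?R
  have A: "partition_on {1..n} A" and B: "partition_on {1..n} B"
    using assms by (auto simp: set_partitions_def)
  show ?L
    unfolding refines_def
  proof (intro conjI ballI A B)
    fix X assume X: "X \<in> A"
    then have sub: "X \<subseteq> {1..n}" and "X \<noteq> {}" using A by (auto simp: partition_on_def)
    then obtain a where a: "a \<in> X" by blast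
    then obtain Y where Y: "Y \<in> B" "a \<in> Y" using B sub by (auto simp: partition_on_def)
    have "b \<in> Y" if b: "b \<in> X" for b
    proof -
      obtain Z where "Z \<in> B" "a \<in> Z" "b \<in> Z" using R a b X sub by blast
      then show ?thesis using Y partition_on_unique[OF B] by metis
    qed
    then show "\<exists>Y\<in>B. X \<subseteq> Y" using Y by blast
  qed
qed

lemma refines_in_set_partitions:
  assumes "refines {1..n} A B"
  shows "A \<in> set_partitions n" "B \<in> set_partitions n"
  using assms by (auto simp: refines_def set_partitions_def)

section \<open>Induction along refinement and sums over lower and upper sets\<close>

lemma finite_refines: "finite S \<Longrightarrow> finite {(A, B). refines S A B \<and> A \<noteq> B}"
  by (rule finite_subset[of _ "{A. partition_on S A} \<times> {A. partition_on S A}"])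
    (auto simp: refines_def finitely_many_partition_on)

lemma acyclic_refines: "acyclic {(A, B). refines S A B \<and> A \<noteq> B}"
proof -
  have "trans {(A, B). refines S A B \<and> A \<noteq> B}"
    by (rule transI) (auto intro: refines_trans dest: refines_asym)
  then show ?thesis by (simp add: acyclic_irrefl trancl_id irrefl_def)
qed

text \<open>The relation is finite and acyclic. Induction along it starts from the finest partition;
  along its converse, from the coarsest.\<close>

lemma wf_refines: "wf {(A, B). refines {1..n::nat} A B \<and> A \<noteq> B}"
  by (rule finite_acyclic_wf[OF finite_refines acyclic_refines]) simp

lemma wf_refines_converse: "wf ({(A, B). refines {1..n::nat} A B \<and> A \<noteq> B}\<inverse>)"
  by (rule finite_acyclic_wf_converse[OF finite_refines acyclic_refines]) simp

lemma finite_refining: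
  fixes n :: nat
  shows "finite {B. refines {1..n} B A}" "finite {B. refines {1..n} A B}"
  by (rule finite_subset[OF _ finite_set_partitions[of n]];
      use refines_in_set_partitions in blast)+

lemma refining_remove:
  assumes "A \<in> set_partitions n"
  shows "{B. refines {1..n} B A} = insert A {B. refines {1..n} B A \<and> B \<noteq> A}"
    and "{B. refines {1..n} A B} = insert A {B. refines {1..n} A B \<and> B \<noteq> A}"
  using assms by (auto simp: set_partitions_def refines_refl)

lemma sum_refining_remove:
  fixes f :: "nat set set \<Rightarrow> 'b::comm_monoid_add"
  assumes "A \<in> set_partitions n"
  shows "sum f {B. refines {1..n} B A} = f A + sum f {B. refines {1..n} B A \<and> B \<noteq> A}"
    and "sum f {B. refines {1..n} A B} = f A + sum f {B. refines {1..n} A B \<and> B \<noteq> A}"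
  unfolding refining_remove[OF assms]
  using finite_refining[of n A] by (subst sum.insert; auto)+

text \<open>The uniqueness half of Moebius inversion: if \<open>f\<close> and \<open>g\<close> agree
  strictly below \<open>A\<close>, equal sums leave equal top terms. The value group is arbitrary
  because formal series as well as tensors are compared.\<close>

lemma sum_refining_inject:
  fixes f g :: "nat set set \<Rightarrow> 'b::ab_group_add"
  assumes eq: "\<And>A. A \<in> set_partitions n \<Longrightarrow>
      sum f {B. refines {1..n} B A} = sum g {B. refines {1..n} B A}"
    and "A \<in> set_partitions n"
  shows "f A = g A"
  using wf_refines[of n] assms(2)
proof (induction A rule: wf_induct_rule)
  case (less A)
  have "sum f {B. refines {1..n} B A \<and> B \<noteq> A} = sum g {B. refines {1..n} B A \<and> B \<noteq> A}"
    by (rule sum.cong) (use less.IH refines_in_set_partitions(1) in auto)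
  then show ?case
    using eq[OF less.prems] by (simp add: sum_refining_remove(1)[OF less.prems])
qed

section \<open>Universal properties of meet and join\<close>

lemma refines_meet_iff:
  assumes "B \<in> set_partitions n" "C \<in> set_partitions n"
  shows "refines {1..n} A (B \<sqinter>\<^bsub>partition_lattice n\<^esub> C) \<longleftrightarrow> refines {1..n} A B \<and> refines {1..n} A C"
proof -
  interpret lattice "partition_lattice n" by (rule lattice_partition_lattice)
  have [simp]: "carrier (partition_lattice n) = set_partitions n"
    "le (partition_lattice n) = refines {1..n}"
    by (simp_all add: partition_lattice_def)
  show ?thesis
    using meet_left[of B C] meet_right[of B C] meet_le[of A B C] assms
      refines_in_set_partitions(1)[of n A] refines_trans by auto
qed

lemma join_refines_iff:
  assumes "A \<in> set_partitions n" "B \<in> set_partitions n"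
  shows "A \<squnion>\<^bsub>partition_lattice n\<^esub> B \<in> set_partitions n"
    and "refines {1..n} (A \<squnion>\<^bsub>partition_lattice n\<^esub> B) C \<longleftrightarrow> refines {1..n} A C \<and> refines {1..n} B C"
proof -
  interpret lattice "partition_lattice n" by (rule lattice_partition_lattice)
  have [simp]: "carrier (partition_lattice n) = set_partitions n"
    "le (partition_lattice n) = refines {1..n}"
    by (simp_all add: partition_lattice_def)
  show "A \<squnion>\<^bsub>partition_lattice n\<^esub> B \<in> set_partitions n"
    using join_closed[of A B] assms by simp
  show "refines {1..n} (A \<squnion>\<^bsub>partition_lattice n\<^esub> B) C \<longleftrightarrow> refines {1..n} A C \<and> refines {1..n} B C"
  proof (intro iffI conjI)
    assume L: "refines {1..n} (A \<squnion>\<^bsub>partition_lattice n\<^esub> B) C"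
    show "refines {1..n} A C" by (rule refines_trans[OF _ L]) (use join_left[of A B] assms in simp)
    show "refines {1..n} B C" by (rule refines_trans[OF _ L]) (use join_right[of A B] assms in simp)
  next
    assume "refines {1..n} A C \<and> refines {1..n} B C"
    then show "refines {1..n} (A \<squnion>\<^bsub>partition_lattice n\<^esub> B) C"
      using join_le[of A C B] assms refines_in_set_partitions(2)[of n A C] by simp
  qed
qed

section \<open>Slash and the refinement order\<close>

text \<open>No part of a slash has elements on both sides of \<open>n\<close>, so pairs straddling
  \<open>n\<close> impose no condition and the two blocks are compared separately.\<close>

lemma slash_refines_iff:
  assumes A: "A \<in> set_partitions n" and B: "B \<in> set_partitions m"
    and C: "C \<in> set_partitions n" and D: "D \<in> set_partitions m"
  shows "refines {1..n+m} (slash n A B) (slash n C D) \<longleftrightarrow>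
    refines {1..n} A C \<and> refines {1..m} B D" (is "?L \<longleftrightarrow> ?R")
proof
  assume L: ?L
  note L = L[unfolded refines_iff_same_part[OF slash_in_set_partitions[OF A B] slash_in_set_partitions[OF C D]],
      rule_format]
  show ?R
    unfolding refines_iff_same_part[OF A C] refines_iff_same_part[OF B D]
  proof (intro conjI ballI impI)
    fix a b assume "a \<in> {1..n}" "b \<in> {1..n}" "\<exists>P\<in>A. a \<in> P \<and> b \<in> P"
    then show "\<exists>P\<in>C. a \<in> P \<and> b \<in> P"
      using L[of a b] slash_same_part[OF A B, of a b] slash_same_part[OF C D, of a b] by simp
  next
    fix a b assume "a \<in> {1..m}" "b \<in> {1..m}" "\<exists>P\<in>B. a \<in> P \<and> b \<in> P"
    then show "\<exists>P\<in>D. a \<in> P \<and> b \<in> P"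
      using L[of "n + a" "n + b"] slash_same_part[OF A B, of "n + a" "n + b"]
        slash_same_part[OF C D, of "n + a" "n + b"] by simp
  qed
next
  assume ?R
  then have AC: "\<And>a b. \<exists>P\<in>A. a \<in> P \<and> b \<in> P \<Longrightarrow> \<exists>P\<in>C. a \<in> P \<and> b \<in> P"
    and BD: "\<And>a b. \<exists>P\<in>B. a \<in> P \<and> b \<in> P \<Longrightarrow> \<exists>P\<in>D. a \<in> P \<and> b \<in> P"
    unfolding refines_def by (meson subsetD)+
  show ?L
    unfolding refines_iff_same_part[OF slash_in_set_partitions[OF A B] slash_in_set_partitions[OF C D]]
  proof (intro ballI impI)
    fix a b assume ab: "a \<in> {1..n+m}" "b \<in> {1..n+m}" "\<exists>P\<in>slash n A B. a \<in> P \<and> b \<in> P"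
    show "\<exists>P\<in>slash n C D. a \<in> P \<and> b \<in> P"
      using ab(3) AC[of a b] BD[of "a - n" "b - n"]
      unfolding slash_same_part[OF A B ab(1,2)] slash_same_part[OF C D ab(1,2)]
      by (simp split: if_splits)
  qed
qed

lemma slash_inject:
  assumes "A \<in> set_partitions n" "B \<in> set_partitions m" "C \<in> set_partitions n" "D \<in> set_partitions m"
    and eq: "slash n A B = slash n C D"
  shows "A = C \<and> B = D"
proof -
  have "refines {1..n+m} (slash n A B) (slash n C D)" "refines {1..n+m} (slash n C D) (slash n A B)"
    using slash_in_set_partitions[OF assms(1,2)] eq by (simp_all add: set_partitions_def refines_refl)
  then show ?thesis using slash_refines_iff assms(1-4) refines_asym by metis
qed

lemma inj_on_slash: "inj_on (\<lambda>(A, B). slash n A B) (set_partitions n \<times> set_partitions m)"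
proof (rule inj_onI, elim SigmaE)
  fix p q A B C D
  assume "A \<in> set_partitions n" "B \<in> set_partitions m" "p = (A, B)"
    "C \<in> set_partitions n" "D \<in> set_partitions m" "q = (C, D)"
    "(case p of (A, B) \<Rightarrow> slash n A B) = (case q of (A, B) \<Rightarrow> slash n A B)"
  then show "p = q" using slash_inject[of A n B m C D] by simp
qed

lemma refines_max_partition: "A \<in> set_partitions n \<Longrightarrow> refines {1..n} A (max_partition n)"
  by (simp add: refines_iff_same_part max_partition_same_part del: atLeastAtMost_iff)

text \<open>Every part of \<open>E\<close> lies in \<open>{1..n}\<close> or in
  \<open>{n+1..n+m}\<close>: the former make up \<open>C\<close>, the latter, shifted back, make up
  \<open>D\<close>. This provides the splittings needed when sums are reindexed along
  \<open>slash\<close>.\<close>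

lemma refines_slash_max_partitionE:
  assumes E: "refines {1..n+m} E (slash n (max_partition n) (max_partition m))"
  obtains C D where "C \<in> set_partitions n" "D \<in> set_partitions m" "E = slash n C D"
proof -
  have pE: "partition_on {1..n+m} E" using E by (simp add: refines_def)
  define C where "C = {P \<in> E. P \<subseteq> {1..n}}"
  define D' where "D' = {P \<in> E. P \<subseteq> {n+1..n+m}}"
  define D where "D = (\<lambda>P. (\<lambda>i. i - n) ` P) ` D'"
  have img: "(\<lambda>i. i + n) ` {1..m} = {n+1..n+m}"
    by (simp add: image_add_atLeastAtMost' add.commute)
  have cases: "P \<in> C \<or> P \<in> D'" if "P \<in> E" for P
  proof -
    have "\<exists>Q\<in>slash n (max_partition n) (max_partition m). P \<subseteq> Q"
      using E that by (simp add: refines_def)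
    then obtain Q where "Q \<in> slash n (max_partition n) (max_partition m)" "P \<subseteq> Q" ..
    \<comment> \<open>Only an inclusion: for \<open>n = 0\<close> or \<open>m = 0\<close> the
      corresponding maximal partition has no part.\<close>
    moreover have "slash n (max_partition n) (max_partition m) \<subseteq>
        {{1..n}} \<union> (\<lambda>P. (\<lambda>i. i + n) ` P) ` {{1..m}}"
      unfolding slash_def max_partition_def by (intro Un_mono image_mono Diff_subset)
    moreover have "(\<lambda>P. (\<lambda>i. i + n) ` P) ` {{1..m}} = {{n+1..n+m}}"
      by (simp only: image_insert image_empty img)
    ultimately have "Q \<in> {{1..n}} \<union> {{n+1..n+m}}" by (metis subsetD)
    with \<open>P \<subseteq> Q\<close> have "P \<subseteq> {1..n} \<or> P \<subseteq> {n+1..n+m}"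
      by (elim UnE singletonE) simp_all
    then show ?thesis using that by (simp add: C_def D'_def)
  qed
  have un: "\<Union>E = {1..n+m}" using pE by (simp add: partition_on_def)
  have subs: "C \<subseteq> E" "D' \<subseteq> E" by (auto simp: C_def D'_def)
  have cov: "{1..n} \<subseteq> \<Union>C"
  proof
    fix a assume a: "a \<in> {1..n}"
    then have "a \<in> \<Union>E" by (simp add: un)
    then obtain P where P: "P \<in> E" "a \<in> P" by (rule UnionE)
    have "P \<notin> D'" using a P(2) by (auto simp: D'_def)
    then show "a \<in> \<Union>C" using cases[OF P(1)] P(2) by blast
  qed
  have cov': "{n+1..n+m} \<subseteq> \<Union>D'"
  proof
    fix a assume a: "a \<in> {n+1..n+m}"
    then have "a \<in> \<Union>E" by (simp add: un)
    then obtain P where P: "P \<in> E" "a \<in> P" by (rule UnionE)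
    have "P \<notin> C" using a P(2) by (auto simp: C_def)
    then show "a \<in> \<Union>D'" using cases[OF P(1)] P(2) by blast
  qed
  have ne: "{} \<notin> E" and dj: "disjoint E" using pE by (simp_all add: partition_on_def)
  have pC: "partition_on {1..n} C"
    unfolding partition_on_def
  proof (intro conjI equalityI cov)
    show "\<Union>C \<subseteq> {1..n}" unfolding C_def by blast
    show "disjoint C" by (rule pairwise_subset[OF dj subs(1)])
    show "{} \<notin> C" using ne subs(1) by blast
  qed
  have pD': "partition_on {n+1..n+m} D'"
    unfolding partition_on_def
  proof (intro conjI equalityI cov')
    show "\<Union>D' \<subseteq> {n+1..n+m}" unfolding D'_def by blast
    show "disjoint D'" by (rule pairwise_subset[OF dj subs(2)])
    show "{} \<notin> D'" using ne subs(2) by blast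
  qed
  \<comment> \<open>Truncated subtraction of \<open>n\<close> is injective here because all elements
    exceed \<open>n\<close>.\<close>
  have "partition_on ((\<lambda>i. i - n) ` {n+1..n+m}) (D - {{}})"
    unfolding D_def by (rule partition_on_inj_image[OF pD']) (auto simp: inj_on_def)
  moreover have "D - {{}} = D" using pD' by (auto simp: D_def partition_on_def)
  moreover have "(\<lambda>i. i - n) ` {n+1..n+m} = {1..m}" by (simp only: img[symmetric] image_image add_diff_cancel_right' image_ident)
  ultimately have pD: "partition_on {1..m} D" by simp
  have "(\<lambda>i. i + n) ` (\<lambda>i. i - n) ` P = P" if "P \<in> D'" for P
  proof -
    have "(\<lambda>i. i + n) ` (\<lambda>i. i - n) ` P = (\<lambda>i. i) ` P"
      unfolding image_image by (rule image_cong) (use that in \<open>auto simp: D'_def\<close>)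
    then show ?thesis by simp
  qed
  then have "(\<lambda>P. (\<lambda>i. i + n) ` P) ` D = D'"
    unfolding D_def by (simp add: image_image cong: image_cong)
  then have "E = slash n C D" unfolding slash_def using cases subs by auto
  then show thesis using that pC pD by (simp add: set_partitions_def)
qed

text \<open>Whatever refines the slash of \<open>A\<close> and \<open>B\<close> also refines the
  slash of the two maximal partitions, hence splits; \<open>slash_refines_iff\<close> then bounds
  both factors.\<close>

lemma bij_betw_slash_refining:
  assumes A: "A \<in> set_partitions n" and B: "B \<in> set_partitions m"
  shows "bij_betw (\<lambda>(C, D). slash n C D)
    ({C. refines {1..n} C A} \<times> {D. refines {1..m} D B}) {E. refines {1..n+m} E (slash n A B)}"
proof (rule bij_betw_imageI)
  show "inj_on (\<lambda>(C, D). slash n C D) ({C. refines {1..n} C A} \<times> {D. refines {1..m} D B})"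
    by (rule inj_on_subset[OF inj_on_slash[of n m]]) (auto dest: refines_in_set_partitions)
  show "(\<lambda>(C, D). slash n C D) ` ({C. refines {1..n} C A} \<times> {D. refines {1..m} D B}) =
    {E. refines {1..n+m} E (slash n A B)}"
  proof (intro equalityI subsetI)
    fix E assume "E \<in> (\<lambda>(C, D). slash n C D) ` ({C. refines {1..n} C A} \<times> {D. refines {1..m} D B})"
    then show "E \<in> {E. refines {1..n+m} E (slash n A B)}"
      using A B refines_in_set_partitions(1) by (auto simp: slash_refines_iff)
  next
    fix E assume "E \<in> {E. refines {1..n+m} E (slash n A B)}"
    then have E: "refines {1..n+m} E (slash n A B)" by simp
    moreover have "refines {1..n+m} (slash n A B) (slash n (max_partition n) (max_partition m))"
      using A B max_partition_same_part(1) by (simp add: slash_refines_iff refines_max_partition)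
    ultimately have "refines {1..n+m} E (slash n (max_partition n) (max_partition m))"
      by (rule refines_trans)
    then obtain C D where CD: "C \<in> set_partitions n" "D \<in> set_partitions m" "E = slash n C D"
      by (rule refines_slash_max_partitionE)
    then show "E \<in> (\<lambda>(C, D). slash n C D) ` ({C. refines {1..n} C A} \<times> {D. refines {1..m} D B})"
      using E A B by (auto simp: slash_refines_iff)
  qed
qed


section \<open>Bilinearity\<close>

lemma sum_fun_apply: "(\<Sum>i\<in>I. f i) w = (\<Sum>i\<in>I. f i w :: 'b::comm_monoid_add)"
  by (induction I rule: infinite_finite_induct) auto

lemma concat_mult_sum:
  "concat_mult (\<Sum>i\<in>I. f i) (\<Sum>j\<in>J. g j) = (\<Sum>i\<in>I. \<Sum>j\<in>J. concat_mult (f i) (g j))"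
proof
  fix w
  have "concat_mult (\<Sum>i\<in>I. f i) (\<Sum>j\<in>J. g j) w =
      (\<Sum>k\<le>length w. \<Sum>i\<in>I. \<Sum>j\<in>J. f i (take k w) * g j (drop k w))"
    by (simp add: concat_mult_def sum_fun_apply sum_product)
  also have "\<dots> = (\<Sum>i\<in>I. \<Sum>k\<le>length w. \<Sum>j\<in>J. f i (take k w) * g j (drop k w))"
    by (rule sum.swap)
  also have "\<dots> = (\<Sum>i\<in>I. \<Sum>j\<in>J. \<Sum>k\<le>length w. f i (take k w) * g j (drop k w))"
    by (intro sum.cong refl sum.swap)
  finally show "concat_mult (\<Sum>i\<in>I. f i) (\<Sum>j\<in>J. g j) w =
      (\<Sum>i\<in>I. \<Sum>j\<in>J. concat_mult (f i) (g j)) w"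
    by (simp add: concat_mult_def sum_fun_apply)
qed

lemma tensor_sum:
  "tensor (\<Sum>i\<in>I. f i) (\<Sum>j\<in>J. g j) = (\<Sum>(i, j)\<in>I \<times> J. tensor (f i) (g j))"
  by (rule ext) (simp add: tensor_def sum_fun_apply sum_product sum.cartesian_product split_def)

lemma internal_comult_zero: "internal_comult d (0 :: nat list \<Rightarrow> 'k::field) = 0"
proof -
  \<comment> \<open>Linearity is available on \<open>NCSym_deg d\<close> only; zero is treated there
    as \<open>0\<close> times itself.\<close>
  have "(0 :: nat list \<Rightarrow> 'k) \<in> NCSym_deg d" unfolding NCSym_deg_def by (rule fvs.span_zero)
  from internal_comult_fscale[OF this, of 0] show ?thesis
    by (simp only: fvs.scale_zero_left)
qed

lemma internal_comult_sum:
  assumes "\<And>i. i \<in> I \<Longrightarrow> f i \<in> NCSym_deg d"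
  shows "internal_comult d (\<Sum>i\<in>I. f i) = (\<Sum>i\<in>I. internal_comult d (f i))"
  using assms
proof (induction I rule: infinite_finite_induct)
  case (insert i I)
  then have "(\<Sum>i\<in>I. f i) \<in> NCSym_deg d" unfolding NCSym_deg_def by (intro fvs.span_sum) auto
  with insert.prems have "internal_comult d (f i + (\<Sum>i\<in>I. f i)) =
      internal_comult d (f i) + internal_comult d (\<Sum>i\<in>I. f i)"
    by (intro internal_comult_add) auto
  with insert show ?case by (simp only: sum.insert insert_iff simp_thms)
\<comment> \<open>A sum over an infinite set is \<open>0\<close> by convention, so that case
  coincides with the empty one.\<close>
qed (simp_all only: sum.infinite sum.empty internal_comult_zero not_False_eq_True)


section \<open>The power sum basis\<close>

text \<open>For a set partition \<open>A\<close> of \<open>{1..n}\<close> this is the formal sum of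
  all words of length \<open>n\<close> in positive letters that are constant on the parts of
  \<open>A\<close>. The argument \<open>n\<close> supplies the ground set to
  \<open>refines\<close>.\<close>

definition powersum :: "nat \<Rightarrow> nat set set \<Rightarrow> nat list \<Rightarrow> 'k::field" where
  "powersum n A = (\<Sum>B | refines {1..n} A B. monomial_sym B)"

lemma powersum_in_NCSym_deg: "powersum n A \<in> NCSym_deg n"
  unfolding powersum_def NCSym_deg_def
  by (intro fvs.span_sum fvs.span_base imageI) (auto dest: refines_in_set_partitions)

text \<open>Unitriangularity: the definition of \<open>powersum n A\<close> is solved for its finest
  term, and the strictly coarser terms are covered by induction from the coarsest partition
  down.\<close>

lemma monomial_sym_in_span_powersum:
  assumes "A \<in> set_partitions n"
  shows "(monomial_sym A :: nat list \<Rightarrow> 'k::field) \<in> fvs.span (powersum n ` set_partitions n)"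
  using wf_refines_converse[of n] assms
proof (induction A rule: wf_induct_rule)
  case (less A)
  have eq: "(monomial_sym A :: nat list \<Rightarrow> 'k) =
      powersum n A - (\<Sum>B | refines {1..n} A B \<and> B \<noteq> A. monomial_sym B)"
    unfolding powersum_def sum_refining_remove(2)[OF less.prems] by simp
  have rest: "(\<Sum>B | refines {1..n} A B \<and> B \<noteq> A. monomial_sym B :: nat list \<Rightarrow> 'k)
      \<in> fvs.span (powersum n ` set_partitions n)"
    by (rule fvs.span_sum, rule less.IH) (auto dest: refines_in_set_partitions(2))
  show ?case
    unfolding eq by (rule fvs.span_diff[OF fvs.span_base[OF imageI[OF less.prems]] rest])
qed

text \<open>Expanding the product yields all \<open>F\<close> whose meet with \<open>?J\<close> is a
  slash of some \<open>C\<close> above \<open>A\<close> and \<open>D\<close> above \<open>B\<close>.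
  These are the \<open>F\<close> above the slash of \<open>A\<close> and \<open>B\<close>, each
  occurring once, since its meet with \<open>?J\<close> splits in exactly one way.\<close>

lemma concat_mult_powersum:
  assumes A: "A \<in> set_partitions n" and B: "B \<in> set_partitions m"
  shows "concat_mult (powersum n A) (powersum m B) =
    (powersum (n + m) (slash n A B) :: nat list \<Rightarrow> 'k::field)"
proof -
  let ?J = "slash n (max_partition n) (max_partition m)"
  let ?T = "{C. refines {1..n} A C} \<times> {D. refines {1..m} B D}"
  let ?R = "\<lambda>E. {F \<in> set_partitions (n + m). F \<sqinter>\<^bsub>partition_lattice (n + m)\<^esub> ?J = E}"
  have J: "?J \<in> set_partitions (n + m)" by (intro slash_in_set_partitions max_partition_same_part)
  have AJ: "refines {1..n+m} (slash n A B) ?J"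
    using A B max_partition_same_part(1) by (simp add: slash_refines_iff refines_max_partition)
  have inj: "inj_on (\<lambda>(C, D). slash n C D) ?T"
    by (rule inj_on_subset[OF inj_on_slash[of n m]]) (auto dest: refines_in_set_partitions)
  have "(\<Union>(C, D)\<in>?T. ?R (slash n C D)) = {F. refines {1..n+m} (slash n A B) F}" (is "?U = ?V")
  proof (intro equalityI subsetI)
    fix F assume "F \<in> ?U"
    then obtain C D where CD: "refines {1..n} A C" "refines {1..m} B D" "F \<in> set_partitions (n + m)"
      "F \<sqinter>\<^bsub>partition_lattice (n + m)\<^esub> ?J = slash n C D" by auto
    then have "refines {1..n+m} (slash n A B) (F \<sqinter>\<^bsub>partition_lattice (n + m)\<^esub> ?J)"
      using A B refines_in_set_partitions(2) by (simp add: slash_refines_iff)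
    then show "F \<in> ?V" using CD(3) J by (simp add: refines_meet_iff)
  next
    fix F assume "F \<in> ?V"
    then have F: "refines {1..n+m} (slash n A B) F" "F \<in> set_partitions (n + m)"
      using refines_in_set_partitions by auto
    let ?M = "F \<sqinter>\<^bsub>partition_lattice (n + m)\<^esub> ?J"
    \<comment> \<open>Reflexivity at the meet, read through \<open>refines_meet_iff\<close>, places
      the meet below \<open>?J\<close>.\<close>
    have "refines {1..n+m} ?M ?M"
      using meet_iff_same_part(1)[OF F(2) J] by (simp add: set_partitions_def refines_refl)
    then have "refines {1..n+m} ?M ?J" using F(2) J by (simp add: refines_meet_iff)
    then obtain C D where CD: "C \<in> set_partitions n" "D \<in> set_partitions m" "?M = slash n C D"
      by (rule refines_slash_max_partitionE)
    have "refines {1..n+m} (slash n A B) ?M" using F J AJ by (simp add: refines_meet_iff)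
    then have "(C, D) \<in> ?T" using A B CD by (simp add: slash_refines_iff)
    then show "F \<in> ?U" using CD(3) F(2) by blast
  qed
  then have "(powersum (n + m) (slash n A B) :: nat list \<Rightarrow> 'k) =
      sum monomial_sym (\<Union>(C, D)\<in>?T. ?R (slash n C D))"
    by (simp add: powersum_def)
  \<comment> \<open>The sets \<open>?R (slash n C D)\<close> are disjoint for distinct pairs because
    \<open>slash\<close> is injective on \<open>?T\<close>.\<close>
  also have "\<dots> = (\<Sum>(C, D)\<in>?T. sum monomial_sym (?R (slash n C D)))"
  proof (subst sum.UNION_disjoint)
    show "\<forall>p\<in>?T. \<forall>q\<in>?T. p \<noteq> q \<longrightarrow>
        (case p of (C, D) \<Rightarrow> ?R (slash n C D)) \<inter> (case q of (C, D) \<Rightarrow> ?R (slash n C D)) = {}"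
    proof (intro ballI impI)
      fix p q assume "p \<in> ?T" "q \<in> ?T" "p \<noteq> q"
      then have "slash n (fst p) (snd p) \<noteq> slash n (fst q) (snd q)"
        using inj_onD[OF inj, of p q] by (auto simp only: split_def)
      then show "(case p of (C, D) \<Rightarrow> ?R (slash n C D)) \<inter> (case q of (C, D) \<Rightarrow> ?R (slash n C D)) = {}"
        unfolding split_def by blast
    qed
    show "\<forall>p\<in>?T. finite (case p of (C, D) \<Rightarrow> ?R (slash n C D))"
      by (simp add: split_def finite_set_partitions)
  qed (simp_all add: finite_refining split_def)
  also have "\<dots> = (\<Sum>(C, D)\<in>?T. concat_mult (monomial_sym C) (monomial_sym D))"
    by (rule sum.cong)
      (auto dest!: refines_in_set_partitions(2) simp: concat_mult_monomial_sym)
  also have "\<dots> = concat_mult (powersum n A) (powersum m B)"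
    by (simp add: powersum_def concat_mult_sum sum.cartesian_product)
  finally show ?thesis by simp
qed

text \<open>A meet lies above \<open>A\<close> iff both of its arguments do, so the terms run over
  all pairs in \<open>?T \<times> ?T\<close>, and the sum factors.\<close>

lemma internal_comult_powersum:
  assumes A: "A \<in> set_partitions n"
  shows "internal_comult n (powersum n A) = tensor (powersum n A) (powersum n A)"
proof -
  let ?T = "{B. refines {1..n} A B}"
  let ?meet = "\<lambda>(B, C). B \<sqinter>\<^bsub>partition_lattice n\<^esub> C"
  have T: "B \<in> set_partitions n" if "B \<in> ?T" for B using that refines_in_set_partitions(2) by simp
  have "internal_comult n (powersum n A) = (\<Sum>E\<in>?T. internal_comult n (monomial_sym E))"
    unfolding powersum_def
    by (rule internal_comult_sum) (auto simp: NCSym_deg_def dest: refines_in_set_partitions intro!: fvs.span_base)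
  \<comment> \<open>Since \<open>E\<close> lies above \<open>A\<close>, a pair with meet
    \<open>E\<close> has both entries in \<open>?T\<close>, so restricting to such pairs loses
    nothing.\<close>
  also have "\<dots> = (\<Sum>E\<in>?T. \<Sum>(B, C) \<in> {p \<in> ?T \<times> ?T. ?meet p = E}. tensor (monomial_sym B) (monomial_sym C))"
    using T by (intro sum.cong)
      (auto simp: internal_comult_monomial_sym refines_meet_iff intro!: sum.cong)
  also have "\<dots> = (\<Sum>(B, C) \<in> ?T \<times> ?T. tensor (monomial_sym B) (monomial_sym C))"
    using T by (intro sum.group) (auto simp: finite_refining refines_meet_iff)
  also have "\<dots> = tensor (powersum n A) (powersum n A)"
    by (simp add: powersum_def tensor_sum)
  finally show ?thesis .
qed


section \<open>The basis of the theorem\<close>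

text \<open>Moebius inversion as a recursion, without an explicit Moebius function. If
  \<open>A\<close> is not a partition of \<open>{1..n}\<close>, all sums involved are empty and the
  value is \<open>0\<close>.\<close>

function xbasis :: "nat \<Rightarrow> nat set set \<Rightarrow> nat list \<Rightarrow> 'k::field" where
  "xbasis n A = powersum n A - (\<Sum>B | refines {1..n} B A \<and> B \<noteq> A. xbasis n B)"
  by auto
termination
\<comment> \<open>The degree \<open>n\<close> stays fixed while \<open>A\<close> descends along
  strict refinement.\<close>
proof (relation "same_fst (\<lambda>_. True) (\<lambda>n::nat. {(A, B). refines {1..n} A B \<and> A \<noteq> B})")
  show "wf (same_fst (\<lambda>_. True) (\<lambda>n::nat. {(A, B). refines {1..n} A B \<and> A \<noteq> B}))"
    by (rule wf_same_fst) (rule wf_refines)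
qed (simp add: same_fst_def)

declare xbasis.simps [simp del]

lemma powersum_eq_sum_xbasis:
  assumes "A \<in> set_partitions n"
  shows "powersum n A = (\<Sum>B | refines {1..n} B A. xbasis n B)"
  unfolding sum_refining_remove(1)[OF assms] by (simp add: xbasis.simps[of n A])

lemma xbasis_in_NCSym_deg: "(xbasis n A :: nat list \<Rightarrow> 'k::field) \<in> NCSym_deg n"
proof (induction n A rule: xbasis.induct)
  case (1 n A)
  have "(\<Sum>B | refines {1..n} B A \<and> B \<noteq> A. xbasis n B :: nat list \<Rightarrow> 'k) \<in> NCSym_deg n"
    unfolding NCSym_deg_def by (rule fvs.span_sum, fold NCSym_deg_def) (rule 1)
  then show ?case
    using powersum_in_NCSym_deg unfolding NCSym_deg_def by (subst xbasis.simps[of n A]) (rule fvs.span_diff)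
qed

text \<open>Summed over the lower sets of both \<open>A\<close> and \<open>B\<close>, either side
  becomes the power sum of the slash. The double sum is then inverted one variable at a
  time.\<close>

lemma concat_mult_xbasis:
  assumes A: "A \<in> set_partitions n" and B: "B \<in> set_partitions m"
  shows "concat_mult (xbasis n A) (xbasis m B) =
    (xbasis (n + m) (slash n A B) :: nat list \<Rightarrow> 'k::field)"
proof -
  have *: "(\<Sum>C | refines {1..n} C A. \<Sum>D | refines {1..m} D B. concat_mult (xbasis n C) (xbasis m D)) =
      (\<Sum>C | refines {1..n} C A. \<Sum>D | refines {1..m} D B.
        xbasis (n + m) (slash n C D) :: nat list \<Rightarrow> 'k)"
    if A: "A \<in> set_partitions n" and B: "B \<in> set_partitions m" for A B
  proof -
    have "(\<Sum>C | refines {1..n} C A. \<Sum>D | refines {1..m} D B. concat_mult (xbasis n C) (xbasis m D)) =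
        (powersum (n + m) (slash n A B) :: nat list \<Rightarrow> 'k)"
      by (simp only: concat_mult_powersum[OF A B, symmetric] concat_mult_sum
          powersum_eq_sum_xbasis[OF A] powersum_eq_sum_xbasis[OF B])
    also have "\<dots> = (\<Sum>E | refines {1..n+m} E (slash n A B). xbasis (n + m) E)"
      by (rule powersum_eq_sum_xbasis[OF slash_in_set_partitions[OF A B]])
    also have "\<dots> = (\<Sum>(C, D)\<in>{C. refines {1..n} C A} \<times> {D. refines {1..m} D B}. xbasis (n + m) (slash n C D))"
      using sum.reindex_bij_betw[OF bij_betw_slash_refining[OF A B], symmetric]
      by (simp only: split_def)
    finally show ?thesis by (simp add: sum.cartesian_product)
  qed
  \<comment> \<open>Inversion in the first variable, with each inner sum over \<open>D\<close>
    regarded as a function of \<open>C\<close>.\<close>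
  have "(\<Sum>D | refines {1..m} D B. concat_mult (xbasis n A) (xbasis m D)) =
      (\<Sum>D | refines {1..m} D B. xbasis (n + m) (slash n A D) :: nat list \<Rightarrow> 'k)" if "B \<in> set_partitions m" for B
    using *[OF _ that] A by (rule sum_refining_inject)
  then show ?thesis using B by (rule sum_refining_inject)
qed

text \<open>Summed over the lower set of \<open>C\<close>, either side becomes
  \<open>tensor (powersum n C) (powersum n C)\<close>, because a join lies below \<open>C\<close>
  iff both arguments do.\<close>

lemma internal_comult_xbasis:
  assumes "C \<in> set_partitions n"
  shows "internal_comult n (xbasis n C) =
    (\<Sum>(A, B) \<in> {(A, B) \<in> set_partitions n \<times> set_partitions n. A \<squnion>\<^bsub>partition_lattice n\<^esub> B = C}.
      tensor (xbasis n A) (xbasis n B))"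
  \<comment> \<open>The placeholder leaves the first premise of \<open>sum_refining_inject\<close>,
    the equality of lower sums, as the goal; \<open>assms\<close> settles the second.\<close>
  using _ assms
proof (rule sum_refining_inject)
  fix C assume C: "C \<in> set_partitions n"
  let ?T = "{B. refines {1..n} B C}"
  let ?join = "\<lambda>(A, B). A \<squnion>\<^bsub>partition_lattice n\<^esub> B"
  have T: "B \<in> set_partitions n" if "B \<in> ?T" for B using that refines_in_set_partitions(1) by simp
  have "(\<Sum>E\<in>?T. internal_comult n (xbasis n E)) = internal_comult n (powersum n C)"
    by (simp only: powersum_eq_sum_xbasis[OF C] internal_comult_sum[OF xbasis_in_NCSym_deg])
  also have "\<dots> = (\<Sum>(A, B) \<in> ?T \<times> ?T. tensor (xbasis n A) (xbasis n B))"
    by (simp only: tensor_sum[symmetric] powersum_eq_sum_xbasis[OF C, symmetric]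
        internal_comult_powersum[OF C])
  also have "\<dots> = (\<Sum>E\<in>?T. \<Sum>(A, B) \<in> {p \<in> ?T \<times> ?T. ?join p = E}. tensor (xbasis n A) (xbasis n B))"
    using T by (intro sum.group[symmetric]) (auto simp: finite_refining join_refines_iff)
  also have "\<dots> = (\<Sum>E\<in>?T. \<Sum>(A, B) \<in> {(A, B) \<in> set_partitions n \<times> set_partitions n.
      A \<squnion>\<^bsub>partition_lattice n\<^esub> B = E}. tensor (xbasis n A) (xbasis n B))"
    using T by (intro sum.cong) (auto simp: join_refines_iff)
  finally show "(\<Sum>E\<in>?T. internal_comult n (xbasis n E)) =
    (\<Sum>E\<in>?T. \<Sum>(A, B) \<in> {(A, B) \<in> set_partitions n \<times> set_partitions n.
      A \<squnion>\<^bsub>partition_lattice n\<^esub> B = E}. tensor (xbasis n A) (xbasis n B))" .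
qed

section \<open>Spanning and linear independence\<close>

lemma monomial_sym_in_span_xbasis:
  assumes "A \<in> set_partitions n"
  shows "(monomial_sym A :: nat list \<Rightarrow> 'k::field) \<in> fvs.span (xbasis n ` set_partitions n)"
proof -
  have "(powersum n ` set_partitions n :: (nat list \<Rightarrow> 'k) set) \<subseteq>
      fvs.span (xbasis n ` set_partitions n)"
  proof (rule image_subsetI)
    fix B assume "B \<in> set_partitions n"
    then show "(powersum n B :: nat list \<Rightarrow> 'k) \<in> fvs.span (xbasis n ` set_partitions n)"
      unfolding powersum_eq_sum_xbasis[OF \<open>B \<in> set_partitions n\<close>]
      by (intro fvs.span_sum fvs.span_base imageI) (auto dest: refines_in_set_partitions)
  qed
  then show ?thesis
    using monomial_sym_in_span_powersum[OF assms] fvs.span_minimal[OF _ fvs.subspace_span]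
    by (metis subsetD)
qed

lemma spanning_family_independent:
  fixes m x :: "'a \<Rightarrow> 'b \<Rightarrow> 'k::field"
  assumes "finite P" "inj_on m P" "fvs.independent (m ` P)" "m ` P \<subseteq> fvs.span (x ` P)"
  shows "inj_on x P" "fvs.independent (x ` P)"
proof -
  have le: "card P \<le> card t" if "finite t" "m ` P \<subseteq> fvs.span t" for t
    using fvs.independent_span_bound[OF that(1) assms(3) that(2)] by (simp add: card_image assms(2))
  have "card P \<le> card (x ` P)" using assms by (intro le) auto
  then show "inj_on x P"
    using assms(1) card_image_le[of P x] by (intro eq_card_imp_inj_on) auto
  show "fvs.independent (x ` P)"
  proof
    assume "fvs.dependent (x ` P)"
    then obtain b where b: "b \<in> x ` P" "b \<in> fvs.span (x ` P - {b})"
      unfolding fvs.dependent_def by blast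
    then have "fvs.span (x ` P) = fvs.span (x ` P - {b})"
      using fvs.span_redundant[OF b(2)] b(1) by (simp add: insert_absorb)
    then have "m ` P \<subseteq> fvs.span (x ` P - {b})" using assms(4) by simp
    then have "card P \<le> card (x ` P - {b})" using assms(1) by (intro le) auto
    also have "\<dots> < card (x ` P)" using assms(1) b(1) by (intro card_Diff1_less) auto
    also have "\<dots> \<le> card P" using assms(1) by (rule card_image_le)
    finally show False by simp
  qed
qed

section \<open>Assembling the basis over all degrees\<close>

theorem theorem1p3:
  shows "\<exists>x :: nat set set \<Rightarrow> (nat list \<Rightarrow> 'k::field_char_0).
    (\<forall>n. \<forall>A\<in>set_partitions n. x A \<in> NCSym_deg n) \<and>
    inj_on x (\<Union>n. set_partitions n) \<and>
    fvs.independent (x ` (\<Union>n. set_partitions n)) \<and>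
    fvs.span (x ` (\<Union>n. set_partitions n)) = NCSym \<and>
    (\<forall>n m. \<forall>A\<in>set_partitions n. \<forall>B\<in>set_partitions m.
       concat_mult (x A) (x B) = x (slash n A B)) \<and>
    (\<forall>n. \<forall>C\<in>set_partitions n.
       internal_comult n (x C) =
         (\<Sum>(A, B) \<in> {(A, B) \<in> set_partitions n \<times> set_partitions n.
                        A \<squnion>\<^bsub>partition_lattice n\<^esub> B = C}.
            tensor (x A) (x B)))"
\<comment> \<open>The witness depends on \<open>A\<close> alone, so the degree is recovered as the
  size of the ground set.\<close>
proof (rule exI[of _ "\<lambda>A. xbasis (card (\<Union>A)) A"], intro conjI allI ballI)
  let ?x = "\<lambda>A. xbasis (card (\<Union>A)) A :: nat list \<Rightarrow> 'k"
  let ?P = "\<Union>n. set_partitions n"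
  \<comment> \<open>Truncating at degree \<open>N\<close> makes the index set finite, as the
    counting argument requires.\<close>
  let ?Q = "\<lambda>N. \<Union>n\<le>N. set_partitions n"
  have x: "?x A = xbasis n A" if "A \<in> set_partitions n" for A n
    using that by (simp add: set_partitions_def partition_on_def)
  \<comment> \<open>The set \<open>S\<close> is left open to serve both the truncations and the
    whole index set.\<close>
  have m_span: "monomial_sym A \<in> fvs.span (?x ` S)" if "A \<in> set_partitions n" "set_partitions n \<subseteq> S" for A n S
  proof -
    have "xbasis n ` set_partitions n = ?x ` set_partitions n" by (rule image_cong) (simp_all add: x)
    then have "xbasis n ` set_partitions n \<subseteq> ?x ` S" using image_mono[OF that(2)] by simp
    from subsetD[OF fvs.span_mono[OF this]] show ?thesis
      using monomial_sym_in_span_xbasis[OF that(1)] .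
  qed
  have Q_P: "?Q N \<subseteq> ?P" for N by (rule UN_mono) simp_all
  have Q: "inj_on ?x (?Q N) \<and> fvs.independent (?x ` ?Q N)" for N
  proof -
    have inj: "inj_on (monomial_sym :: _ \<Rightarrow> _ \<Rightarrow> 'k) (?Q N)"
      by (rule inj_on_subset[OF inj_on_monomial_sym Q_P])
    have ind: "fvs.independent (monomial_sym ` ?Q N :: (_ \<Rightarrow> 'k) set)"
      by (rule fvs.independent_mono[OF independent_monomial_sym image_mono[OF Q_P]])
    have span: "monomial_sym ` ?Q N \<subseteq> fvs.span (?x ` ?Q N)"
    proof (rule image_subsetI, elim UN_E)
      fix A n assume "A \<in> set_partitions n" "n \<in> {..N}"
      then show "monomial_sym A \<in> fvs.span (?x ` ?Q N)"
        by (rule m_span[OF _ UN_upper[where B = set_partitions]])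
    qed
    have "finite (?Q N)" by (simp add: finite_set_partitions)
    then show ?thesis using spanning_family_independent[OF _ inj ind span] by (intro conjI)
  qed
  show "inj_on ?x ?P"
  proof (rule inj_onI)
    fix A B assume "A \<in> ?P" "B \<in> ?P" and eq: "?x A = ?x B"
    then obtain n m where AB: "A \<in> set_partitions n" "B \<in> set_partitions m" by (elim UN_E)
    have "A \<in> ?Q (max n m)" by (rule UN_I[where B = set_partitions, OF _ AB(1)]) simp
    moreover have "B \<in> ?Q (max n m)" by (rule UN_I[where B = set_partitions, OF _ AB(2)]) simp
    ultimately show "A = B" by (rule inj_onD[OF conjunct1[OF Q] eq])
  qed
  \<comment> \<open>The truncated families form a chain, and independence passes to the union of a
    chain.\<close>
  have "fvs.independent (\<Union>N. ?x ` ?Q N)"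
  proof (rule fvs.independent_Union_directed)
    fix c d assume "c \<in> range (\<lambda>N. ?x ` ?Q N)" "d \<in> range (\<lambda>N. ?x ` ?Q N)"
    then obtain N M where NM: "c = ?x ` ?Q N" "d = ?x ` ?Q M" by (elim rangeE)
    have mono: "?x ` ?Q N \<subseteq> ?x ` ?Q M" if "N \<le> M" for N M
      by (intro image_mono UN_mono) (use that in simp_all)
    show "c \<subseteq> d \<or> d \<subseteq> c" unfolding NM using linear[of N M] mono by (elim disjE) simp_all
  next
    fix c assume "c \<in> range (\<lambda>N. ?x ` ?Q N)"
    then obtain N where c: "c = ?x ` ?Q N" by (elim rangeE)
    show "fvs.independent c" unfolding c by (rule conjunct2[OF Q])
  qed
  moreover have "(\<Union>N. ?Q N) = ?P"
  proof
    show "(\<Union>N. ?Q N) \<subseteq> ?P" by (rule UN_least[OF Q_P])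
    show "?P \<subseteq> (\<Union>N. ?Q N)" by (rule UN_mono[OF subset_refl], rule UN_upper) simp
  qed
  then have "(\<Union>N. ?x ` ?Q N) = ?x ` ?P" by (simp only: image_UN[symmetric])
  ultimately show "fvs.independent (?x ` ?P)" by simp
  show deg: "?x A \<in> NCSym_deg n" if "A \<in> set_partitions n" for A n
    using x[OF that] xbasis_in_NCSym_deg by simp
  show "fvs.span (?x ` ?P) = NCSym"
  \<comment> \<open>Each inclusion reduces to placing one family of generators in the span of the
    other.\<close>
  proof (rule equalityI; unfold NCSym_def; rule fvs.span_minimal[OF _ fvs.subspace_span])
    have "NCSym_deg n \<subseteq> (fvs.span (monomial_sym ` ?P) :: (_ \<Rightarrow> 'k) set)" for n
      unfolding NCSym_deg_def by (intro fvs.span_mono image_mono UN_upper UNIV_I)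
    then show "?x ` ?P \<subseteq> fvs.span (monomial_sym ` ?P)"
      by (intro image_subsetI, elim UN_E) (rule subsetD[OF _ deg])
    show "monomial_sym ` ?P \<subseteq> fvs.span (?x ` ?P)"
      by (intro image_subsetI, elim UN_E) (rule m_span[OF _ UN_upper[where B = set_partitions, OF UNIV_I]])
  qed
  show "concat_mult (?x A) (?x B) = ?x (slash n A B)"
    if "A \<in> set_partitions n" "B \<in> set_partitions m" for n m A B
    using that by (simp only: x[OF that(1)] x[OF that(2)] x[OF slash_in_set_partitions[OF that]] concat_mult_xbasis)
  show "internal_comult n (?x C) =
      (\<Sum>(A, B) \<in> {(A, B) \<in> set_partitions n \<times> set_partitions n. A \<squnion>\<^bsub>partition_lattice n\<^esub> B = C}.
         tensor (?x A) (?x B))" if "C \<in> set_partitions n" for n C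
    unfolding x[OF that] internal_comult_xbasis[OF that]
    by (rule sum.cong) (clarsimp simp: x[of _ n])+
qed

end
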